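(* For every integer $m\ge 1$ and every $n\ge 0$, the expected value of $\overline{\mu}_{2m}$ on permutations of size $n$ is $$\mathbb{E}(\overline{\mu}_{2m})=\frac{1}{m+1}\binom{n+m}{2m+1}.$$
   Context: For an integer $r\ge 1$, the $r$th binomial permutation moment of a permutation $w$ of $\{1,\dots,n\}$ is $$\overline{\mu}_r(w)=\sum_{i\ge 1}\binom{w(i)-i+\lceil r/2\rceil-1}{r},$$ where by convention $w(i)=i$ for $i>n$, and $\binom{x}{j}=x(x-1)\cdots(x-j+1)/j!$ for any integer $x$ (possibly negative) and integer $j\ge 0$. The expected value is taken with respect to the uniform distribution on the set $S_n$ of permutations of $\{1,\dots,n\}$. *)

theory Defs
  imports "HOL-Probability.Probability" "HOL-Combinatorics.Permutations"
begin

text \<open>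
  A permutation \<open>w\<close> of \<open>{1..n}\<close> is a function with \<open>w permutes {1..n}\<close>, so \<open>w i = i\<close> for \<open>i > n\<close>
  holds automatically. For \<open>r \<ge> 1\<close> the summand at a fixed point is
  \<open>(\<lceil>r/2\<rceil> - 1) gchoose r = 0\<close>, since \<open>0 \<le> \<lceil>r/2\<rceil> - 1 < r\<close>; the infinite sum therefore has only
  finitely many nonzero terms. The upper argument may be negative, hence the real-valued
  \<open>gchoose\<close>, which is \<open>x (x - 1) \<dots> (x - r + 1) / r!\<close>.
\<close>

definition binomial_permutation_moment :: "nat \<Rightarrow> (nat \<Rightarrow> nat) \<Rightarrow> real" where
  "binomial_permutation_moment r w =
     (\<Sum>\<^sub>\<infinity>i\<in>{1..}. real_of_int (int (w i) - int i + \<lceil>real r / 2\<rceil> - 1) gchoose r)"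

definition uniform_permutation :: "nat \<Rightarrow> (nat \<Rightarrow> nat) pmf" where
  "uniform_permutation n = pmf_of_set {w. w permutes {1..n}}"

end

theory Submission imports Defs begin

text \<open>
  Let \<open>n > 0\<close>. Under a uniform permutation of \<open>{1..n}\<close> each value \<open>w i\<close> is uniform on \<open>{1..n}\<close>, so by linearity
  the expectation is \<open>1/n\<close> times the double sum of \<open>(j - i + m - 1) gchoose (2 * m)\<close> over all
  \<open>i, j \<in> {1..n}\<close> (\<open>expectation_sum_permutation_entries\<close>). Because the generalized binomial
  coefficients satisfy Pascal's rule for every upper argument, negative ones included, the sum over
  \<open>j\<close> telescopes to lower index \<open>2 * m + 1\<close> and the sum over \<open>i\<close> then telescopes to \<open>2 * m + 2\<close>.
  Of the four resulting boundary terms two are \<open>m gchoose (2 * m + 2) = 0\<close>. The other two are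
  \<open>(n + m) gchoose (2 * m + 2)\<close> and \<open>(m - n) gchoose (2 * m + 2)\<close>, and upper negation turns the
  latter into \<open>(n + m + 1) gchoose (2 * m + 2)\<close>. By Pascal's rule and absorption these two add up
  to \<open>n / (m + 1)\<close> times \<open>(n + m) choose (2 * m + 1)\<close>, and the factor \<open>n\<close> cancels the
  probability \<open>1/n\<close> (\<open>double_sum_gchoose\<close>). For \<open>n = 0\<close> both sides vanish.
\<close>

text \<open>
  Precomposing with the transposition of \<open>i\<close> and \<open>a\<close> permutes the permutations of \<open>A\<close> among
  themselves, so the left-hand sum does not depend on \<open>i\<close>. Summing it over \<open>i \<in> A\<close> gives, for each
  single permutation, the sum of \<open>f\<close> over all of \<open>A\<close>.
\<close>
lemma sum_permutations_entry:
  fixes f :: "'a \<Rightarrow> 'b::comm_semiring_1"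
  assumes "i \<in> A"
  shows "of_nat (card A) * (\<Sum>w | w permutes A. f (w i)) =
    of_nat (card {w. w permutes A}) * (\<Sum>j\<in>A. f j)"
proof -
  have entry_indep: "(\<Sum>w | w permutes A. f (w i)) = (\<Sum>w | w permutes A. f (w a))" if "a \<in> A" for a
  proof (rule sum.reindex_bij_witness[of _ "\<lambda>w. w \<circ> Transposition.transpose i a" "\<lambda>w. w \<circ> Transposition.transpose i a"])
    fix w assume "w \<in> {w. w permutes A}"
    then show "w \<circ> Transposition.transpose i a \<in> {w. w permutes A}"
      using that assms by (auto intro: permutes_compose permutes_swap_id)
    then show "w \<circ> Transposition.transpose i a \<in> {w. w permutes A}" .
  qed (auto simp: fun_eq_iff)
  have "of_nat (card A) * (\<Sum>w | w permutes A. f (w i)) = (\<Sum>a\<in>A. \<Sum>w | w permutes A. f (w i))"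
    by simp
  also have "\<dots> = (\<Sum>a\<in>A. \<Sum>w | w permutes A. f (w a))"
    by (intro sum.cong refl entry_indep)
  also have "\<dots> = (\<Sum>w | w permutes A. \<Sum>a\<in>A. f (w a))"
    by (rule sum.swap)
  also have "\<dots> = (\<Sum>w | w permutes A. \<Sum>j\<in>A. f j)"
    by (intro sum.cong refl sum.reindex_bij_betw) (simp add: permutes_imp_bij)
  finally show ?thesis by simp
qed

lemma expectation_sum_permutation_entries:
  fixes g :: "nat \<Rightarrow> nat \<Rightarrow> real"
  assumes "n > 0"
  shows "measure_pmf.expectation (uniform_permutation n) (\<lambda>w. \<Sum>i=1..n. g i (w i)) =
    (\<Sum>i=1..n. \<Sum>j=1..n. g i j) / n"
proof -
  let ?P = "{w. w permutes {1..n}}"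
  have fin: "finite ?P" by (simp add: finite_permutations)
  have ne: "?P \<noteq> {}" using permutes_id by blast
  have "card ?P > 0" using fin ne by (simp add: card_gt_0_iff)
  have entry: "(\<Sum>w\<in>?P. g i (w i)) = card ?P * (\<Sum>j=1..n. g i j) / n" if "i \<in> {1..n}" for i
    using sum_permutations_entry[OF that, of "g i"] assms by (simp add: field_simps)
  have "measure_pmf.expectation (uniform_permutation n) (\<lambda>w. \<Sum>i=1..n. g i (w i)) =
      (\<Sum>w\<in>?P. \<Sum>i=1..n. g i (w i)) / card ?P"
    unfolding uniform_permutation_def using ne fin by (rule integral_pmf_of_set)
  also have "(\<Sum>w\<in>?P. \<Sum>i=1..n. g i (w i)) = (\<Sum>i=1..n. card ?P * (\<Sum>j=1..n. g i j) / n)"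
    by (subst sum.swap) (intro sum.cong refl entry)
  also have "\<dots> = card ?P * ((\<Sum>i=1..n. \<Sum>j=1..n. g i j) / n)"
    by (simp add: sum_distrib_left sum_divide_distrib)
  finally show ?thesis using \<open>card ?P > 0\<close> by simp
qed

lemma sum_gchoose_ascending:
  fixes a :: "'a::field_char_0"
  shows "(\<Sum>j=1..n. (a + of_nat j - 1) gchoose k) = (a + of_nat n gchoose Suc k) - (a gchoose Suc k)"
proof (induction n)
  case (Suc n)
  then show ?case
    using gbinomial_Suc_Suc[of "a + of_nat n" k] by (simp add: algebra_simps)
qed simp

lemma sum_gchoose_descending:
  fixes a :: "'a::field_char_0"
  shows "(\<Sum>i=1..n. (a - of_nat i) gchoose k) = (a gchoose Suc k) - (a - of_nat n gchoose Suc k)"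
proof (induction n)
  case (Suc n)
  then show ?case
    using gbinomial_Suc_Suc[of "a - of_nat n - 1" k] by (simp add: algebra_simps)
qed simp

lemma double_sum_gchoose:
  "(\<Sum>i=1..n. \<Sum>j=1..n. (real j - real i + real m - 1) gchoose (2 * m)) =
    real n / (real m + 1) * real ((n + m) choose (2 * m + 1))"
proof -
  let ?k = "2 * m + 1"
  have inner: "(\<Sum>j=1..n. (real j - real i + real m - 1) gchoose (2 * m)) =
      (real (n + m) - real i gchoose ?k) - (real m - real i gchoose ?k)" for i
    using sum_gchoose_ascending[of "real m - real i" "2 * m" n] by (simp add: algebra_simps)
  have vanish: "real m gchoose Suc ?k = 0"
    by (simp flip: binomial_gbinomial)
  have negate: "real m - real n gchoose Suc ?k = real (n + m + 1) gchoose Suc ?k"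
    by (subst gbinomial_negated_upper) (simp add: algebra_simps)
  have "(\<Sum>i=1..n. \<Sum>j=1..n. (real j - real i + real m - 1) gchoose (2 * m)) =
      (real (n + m) gchoose Suc ?k) + (real (n + m + 1) gchoose Suc ?k)"
    unfolding inner sum_subtractf sum_gchoose_descending negate
    using vanish by simp
  also have "\<dots> = 2 * (real (n + m) gchoose Suc ?k) + (real (n + m) gchoose ?k)"
    using gbinomial_Suc_Suc[of "real (n + m)" ?k] by (simp add: algebra_simps)
  also have "real (n + m) gchoose Suc ?k =
      (real n - real m - 1) / (2 * (real m + 1)) * (real (n + m) gchoose ?k)"
    using gbinomial_mult_1[of "real (n + m)" ?k] by (simp add: field_simps)
  also have "2 * \<dots> + (real (n + m) gchoose ?k) =
      real n / (real m + 1) * (real (n + m) gchoose ?k)"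
    by (simp add: field_simps)
  finally show ?thesis by (simp only: binomial_gbinomial)
qed

lemma even_binomial_permutation_moment_eq_sum:
  assumes "m \<ge> 1" and "w permutes {1..n}"
  shows "binomial_permutation_moment (2 * m) w =
    (\<Sum>i=1..n. (real (w i) - real i + real m - 1) gchoose (2 * m))"
proof -
  have "binomial_permutation_moment (2 * m) w =
      (\<Sum>\<^sub>\<infinity>i\<in>{1..}. (real (w i) - real i + real m - 1) gchoose (2 * m))"
    by (simp add: binomial_permutation_moment_def)
  also have "\<dots> = (\<Sum>\<^sub>\<infinity>i\<in>{1..n}. (real (w i) - real i + real m - 1) gchoose (2 * m))"
  proof (rule infsum_cong_neutral)
    fix i assume "i \<in> {1..} - {1..n}"
    then have "w i = i" using assms(2) by (auto simp: permutes_def)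
    then have "(real (w i) - real i + real m - 1) gchoose (2 * m) = real (m - 1) gchoose (2 * m)"
      using assms(1) by simp
    also have "\<dots> = real ((m - 1) choose (2 * m))"
      by (rule binomial_gbinomial[symmetric])
    \<comment> \<open>The lower index exceeds \<open>m - 1\<close> precisely because \<open>m\<close> is positive.\<close>
    also have "\<dots> = 0" using assms(1) by (simp add: binomial_eq_0)
    finally show "(real (w i) - real i + real m - 1) gchoose (2 * m) = 0" .
  qed auto
  finally show ?thesis by simp
qed

theorem proposition3p12:
  fixes m n :: nat
  assumes "m \<ge> 1"
  shows "measure_pmf.expectation (uniform_permutation n) (binomial_permutation_moment (2 * m)) =
           1 / (real m + 1) * real ((n + m) choose (2 * m + 1))"
proof -
  let ?g = "\<lambda>i j :: nat. (real j - real i + real m - 1) gchoose (2 * m)"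
  have supp: "set_pmf (uniform_permutation n) = {w. w permutes {1..n}}"
    unfolding uniform_permutation_def
    by (rule set_pmf_of_set) (use permutes_id in blast, simp add: finite_permutations)
  have as_sum: "measure_pmf.expectation (uniform_permutation n) (binomial_permutation_moment (2 * m)) =
      measure_pmf.expectation (uniform_permutation n) (\<lambda>w. \<Sum>i=1..n. ?g i (w i))"
    by (rule integral_cong_AE)
      (auto simp: AE_measure_pmf_iff supp even_binomial_permutation_moment_eq_sum[OF assms])
  show ?thesis
  proof (cases "n = 0")
    case True
    then show ?thesis using as_sum by (simp add: binomial_eq_0)
  next
    case False
    then show ?thesis
      using as_sum expectation_sum_permutation_entries[of n ?g] double_sum_gchoose[where n = n and m = m]
      by simp
  qed
qed

end
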